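(* Let $\kappa$ be a fixed point of the aleph hierarchy, i.e. a cardinal with $\kappa = \aleph_\kappa$, and let $G$ be a connected $\kappa$-regular graph. Then $D'(G) \leq 2$.
   Context: We work in ZFC and identify cardinal numbers with initial ordinals. The aleph hierarchy is defined by transfinite induction: $\aleph_0 = |\mathbb{N}|$; $\aleph_{\alpha+1} = \aleph_\alpha^+$ (the least cardinal greater than $\aleph_\alpha$) for every ordinal $\alpha$; and $\aleph_\alpha = \sup\{\aleph_\beta : \beta < \alpha\}$ for every limit ordinal $\alpha$. Graphs are simple and undirected. A graph is $\kappa$-regular if every vertex has degree (number of neighbours) exactly $\kappa$. An edge-colouring of $G$ (any map from the edge set to a set of colours, not necessarily proper) is distinguishing if the only automorphism of $G$ that preserves the colouring is the identity. The distinguishing index $D'(G)$ is the least number of colours in a distinguishing edge-colouring of $G$. *)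

theory Defs
  imports Main
begin

unbundle cardinal_syntax

text \<open>
  Ordinals are well-orders up to order isomorphism, cardinals are the relations satisfying
  \<^const>\<open>Card_order\<close> (initial ordinals), and \<^const>\<open>ordLess\<close>, \<^const>\<open>ordLeq\<close>, \<^const>\<open>ordIso\<close> compare them, also
  across types. Every ordinal below a well-order \<open>r\<close> of type \<open>'a rel\<close> is isomorphic to an initial
  segment of \<open>r\<close>, hence is represented in \<open>'a rel\<close>; so in the definitions below it is no
  restriction that the bound variables range over well-orders of the same type.
\<close>

definition is_ord_succ :: "'a rel \<Rightarrow> 'a rel \<Rightarrow> bool" where
  "is_ord_succ \<beta> \<alpha> \<longleftrightarrow> \<beta> <o \<alpha> \<and> (\<forall>\<gamma>::'a rel. \<beta> <o \<gamma> \<longrightarrow> \<alpha> \<le>o \<gamma>)"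

definition is_limit_ord :: "'a rel \<Rightarrow> bool" where
  "is_limit_ord \<alpha> \<longleftrightarrow> Well_order \<alpha> \<and> Field \<alpha> \<noteq> {} \<and> (\<forall>\<beta>. \<not> is_ord_succ \<beta> \<alpha>)"

definition is_ord_sup :: "'b rel set \<Rightarrow> 'b rel \<Rightarrow> bool" where
  "is_ord_sup S \<sigma> \<longleftrightarrow> Well_order \<sigma> \<and> (\<forall>\<rho>\<in>S. \<rho> \<le>o \<sigma>) \<and>
     (\<forall>\<tau>::'b rel. Well_order \<tau> \<and> (\<forall>\<rho>\<in>S. \<rho> \<le>o \<tau>) \<longrightarrow> \<sigma> \<le>o \<tau>)"

text \<open>
  \<open>is_aleph \<alpha> \<mu>\<close> says that \<open>\<mu>\<close> is the cardinal aleph-\<open>\<alpha>\<close>. It is a relation rather than a function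
  because aleph-\<open>\<alpha>\<close> need not be representable in \<open>'b rel\<close> when the type \<open>'b\<close> is too small.
\<close>

inductive is_aleph :: "'a rel \<Rightarrow> 'b rel \<Rightarrow> bool" where
  zero: "\<lbrakk>Well_order \<alpha>; Field \<alpha> = {}; \<mu> =o natLeq\<rbrakk> \<Longrightarrow> is_aleph \<alpha> \<mu>"
| succ: "\<lbrakk>is_ord_succ \<beta> \<alpha>; is_aleph \<beta> \<nu>; \<mu> =o cardSuc \<nu>\<rbrakk> \<Longrightarrow> is_aleph \<alpha> \<mu>"
| limit: "\<lbrakk>is_limit_ord \<alpha>; \<forall>\<beta>. \<beta> <o \<alpha> \<longrightarrow> is_aleph \<beta> (A \<beta>); is_ord_sup {A \<beta> |\<beta>. \<beta> <o \<alpha>} \<mu>\<rbrakk>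
    \<Longrightarrow> is_aleph \<alpha> \<mu>"

definition aleph_fixed_point :: "'k rel \<Rightarrow> bool" where
  "aleph_fixed_point \<kappa> \<longleftrightarrow> Card_order \<kappa> \<and> is_aleph \<kappa> \<kappa>"

definition simple_graph :: "'v set \<Rightarrow> 'v set set \<Rightarrow> bool" where
  "simple_graph V E \<longleftrightarrow> (\<forall>e\<in>E. e \<subseteq> V \<and> card e = 2)"

definition connected_graph :: "'v set \<Rightarrow> 'v set set \<Rightarrow> bool" where
  "connected_graph V E \<longleftrightarrow> (\<forall>u\<in>V. \<forall>v\<in>V. (u, v) \<in> {(x, y). {x, y} \<in> E}\<^sup>*)"

definition neighbours :: "'v set set \<Rightarrow> 'v \<Rightarrow> 'v set" where
  "neighbours E v = {u. {v, u} \<in> E}"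

definition regular_graph :: "'k rel \<Rightarrow> 'v set \<Rightarrow> 'v set set \<Rightarrow> bool" where
  "regular_graph \<kappa> V E \<longleftrightarrow> (\<forall>v\<in>V. |neighbours E v| =o \<kappa>)"

definition graph_automorphism :: "'v set \<Rightarrow> 'v set set \<Rightarrow> ('v \<Rightarrow> 'v) \<Rightarrow> bool" where
  "graph_automorphism V E \<phi> \<longleftrightarrow>
     bij_betw \<phi> V V \<and> (\<forall>x\<in>V. \<forall>y\<in>V. {\<phi> x, \<phi> y} \<in> E \<longleftrightarrow> {x, y} \<in> E)"

definition distinguishing_colouring :: "'v set \<Rightarrow> 'v set set \<Rightarrow> ('v set \<Rightarrow> 'c) \<Rightarrow> bool" where
  "distinguishing_colouring V E c \<longleftrightarrow>
     (\<forall>\<phi>. graph_automorphism V E \<phi> \<and> (\<forall>e\<in>E. c (\<phi> ` e) = c e) \<longrightarrow> (\<forall>v\<in>V. \<phi> v = v))"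

text \<open>
  Since a colouring of \<open>E\<close> uses at most \<open>|E|\<close> colours, up to renaming the colours can be taken from
  the type \<open>'v set\<close> of edges. The index is a relation because some graphs (for instance a single
  edge) have no distinguishing edge-colouring at all.
\<close>

definition is_distinguishing_index :: "'v set \<Rightarrow> 'v set set \<Rightarrow> 'v set rel \<Rightarrow> bool" where
  "is_distinguishing_index V E d \<longleftrightarrow>
     (\<exists>c :: 'v set \<Rightarrow> 'v set. distinguishing_colouring V E c \<and> d =o |c ` E| ) \<and>
     (\<forall>c :: 'v set \<Rightarrow> 'v set. distinguishing_colouring V E c \<longrightarrow> d \<le>o |c ` E| )"

end

theory Submission
  imports Defs
begin

text \<open>
  The proof produces a spanning subgraph \<open>F\<close> of \<open>G\<close> in which any two vertices have different
  degrees. Colouring \<open>F\<close> red and the other edges blue is then distinguishing: a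
  colour-preserving automorphism preserves the red degree of every vertex
  (\<open>distinguishing_if_red_degrees_distinct\<close>).

  Being connected and \<open>\<kappa>\<close>-regular, \<open>G\<close> has \<open>\<kappa>\<close> vertices unless it is empty, so they can be arranged in a well-order
  of type \<open>\<kappa>\<close> in which every vertex has fewer than \<open>\<kappa>\<close> predecessors. The fixed-point property
  says that there are as many infinite cardinals below \<open>\<kappa>\<close> as there are vertices; mapping the
  vertices to these cardinals in increasing order assigns to every \<open>v\<close> an infinite cardinal
  \<open>c v < \<kappa>\<close> that is at least the number of predecessors of \<open>v\<close>, with different cardinals for
  different vertices (\<open>aleph_fixed_point_cardinal_labels\<close>). Now join every \<open>v\<close> by red edges to
  exactly \<open>c v\<close> of its neighbours that come later in the order: this is possible since only
  fewer than \<open>\<kappa>\<close> of its \<open>\<kappa>\<close> neighbours are not later. The other red edges at \<open>v\<close> come from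
  predecessors of \<open>v\<close>, hence there are at most \<open>c v\<close> of them, and the red degree of \<open>v\<close> is exactly
  \<open>c v\<close> (\<open>spanning_subgraph_with_degrees\<close>). Since the labels \<open>c v\<close> are fixed beforehand, the
  choices at different vertices are independent of each other.
\<close>

section \<open>Infinite cardinals below a fixed point of the aleph hierarchy\<close>

abbreviation initial_segment :: "'a rel \<Rightarrow> 'a \<Rightarrow> 'a rel" where
  "initial_segment r z \<equiv> Restr r (underS r z)"

lemma Field_initial_segment:
  assumes "Well_order r"
  shows "Field (initial_segment r z) = underS r z"
  using assms by (simp add: Field_Restr_ofilter wo_rel.underS_ofilter wo_rel_def)

lemma initial_segment_ordLeq:
  assumes "Well_order r" and "(y, z) \<in> r"
  shows "initial_segment r y \<le>o initial_segment r z"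
proof -
  have "underS r y \<subseteq> underS r z"
    using assms unfolding underS_def well_order_on_def linear_order_on_def partial_order_on_def
      preorder_on_def antisym_def trans_def by blast
  then show ?thesis
    using assms(1) by (simp add: ofilter_subset_ordLeq[symmetric] wo_rel.underS_ofilter wo_rel_def)
qed

lemma initial_segment_ordIso_imp_eq:
  assumes r: "Well_order r" and "y \<in> Field r" and "z \<in> Field r"
    and iso: "initial_segment r y =o initial_segment r z"
  shows "y = z"
proof -
  have strict: False
    if "(a, b) \<in> r" "a \<noteq> b" "initial_segment r a =o initial_segment r b" for a b
  proof -
    have "underS r a \<subset> underS r b"
      using that r unfolding underS_def well_order_on_def linear_order_on_def partial_order_on_def
        preorder_on_def antisym_def trans_def by blast
    then have "initial_segment r a <o initial_segment r b"
      using r by (simp add: ofilter_subset_ordLess[symmetric] wo_rel.underS_ofilter wo_rel_def)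
    then show False
      using that(3) not_ordLess_ordIso by blast
  qed
  have "(y, z) \<in> r \<or> (z, y) \<in> r \<or> y = z"
    using r assms(2,3) unfolding well_order_on_def linear_order_on_def total_on_def by blast
  then show ?thesis
    using strict iso ordIso_symmetric by blast
qed

text \<open>
  Cardinals below \<open>\<mu>\<close> are represented by the points of one ambient well-order \<open>r\<close>. If \<open>\<mu> \<le>o r\<close>, then
  each infinite cardinal below \<open>\<mu>\<close> corresponds to exactly one element of this set, and restricting
  \<open>r\<close> to it lists these cardinals in increasing order.
\<close>

definition infinite_cardinals_below :: "'a rel \<Rightarrow> 'b rel \<Rightarrow> 'a set" where
  "infinite_cardinals_below r \<mu> =
     {z \<in> Field r. Cinfinite (initial_segment r z) \<and> initial_segment r z <o \<mu>}"

lemma infinite_cardinals_below_Field: "infinite_cardinals_below r \<mu> \<subseteq> Field r"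
  by (auto simp: infinite_cardinals_below_def)

lemma Field_Restr_infinite_cardinals_below:
  assumes "Well_order r"
  shows "Field (Restr r (infinite_cardinals_below r \<mu>)) = infinite_cardinals_below r \<mu>"
  using assms by (intro Refl_Field_Restr2 infinite_cardinals_below_Field)
    (auto simp: well_order_on_def linear_order_on_def partial_order_on_def preorder_on_def)

lemma infinite_cardinals_below_mono:
  "\<nu> \<le>o \<mu> \<Longrightarrow> infinite_cardinals_below r \<nu> \<subseteq> infinite_cardinals_below r \<mu>"
  unfolding infinite_cardinals_below_def using ordLess_ordLeq_trans by blast

lemma infinite_cardinals_below_ofilter:
  assumes r: "Well_order r" and le: "\<nu> \<le>o \<mu>"
  shows "wo_rel.ofilter (Restr r (infinite_cardinals_below r \<mu>)) (infinite_cardinals_below r \<nu>)"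
proof -
  have "y \<in> infinite_cardinals_below r \<nu>"
    if "z \<in> infinite_cardinals_below r \<nu>" "y \<in> infinite_cardinals_below r \<mu>" "(y, z) \<in> r" for y z
    using that initial_segment_ordLeq[OF r that(3)] ordLeq_ordLess_trans
    unfolding infinite_cardinals_below_def by blast
  then show ?thesis
    using infinite_cardinals_below_mono[OF le, of r] Well_order_Restr[OF r]
    unfolding wo_rel.ofilter_def[OF wo_rel.intro[OF Well_order_Restr[OF r]]]
      Field_Restr_infinite_cardinals_below[OF r] under_def
    by blast
qed

lemma Restr_infinite_cardinals_below_mono:
  assumes r: "Well_order r" and le: "\<nu> \<le>o \<mu>"
  shows "Restr r (infinite_cardinals_below r \<nu>) \<le>o Restr r (infinite_cardinals_below r \<mu>)"
proof -
  let ?R = "Restr r (infinite_cardinals_below r \<mu>)"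
  have "infinite_cardinals_below r \<nu> \<subseteq> infinite_cardinals_below r \<mu>"
    by (rule infinite_cardinals_below_mono[OF le])
  moreover have "wo_rel.ofilter ?R (infinite_cardinals_below r \<mu>)"
    using infinite_cardinals_below_ofilter[OF r ordLeq_reflexive] le ordLeq_Well_order_simp by blast
  ultimately have "Restr ?R (infinite_cardinals_below r \<nu>) \<le>o
      Restr ?R (infinite_cardinals_below r \<mu>)"
    using ofilter_subset_ordLeq[OF Well_order_Restr[OF r] infinite_cardinals_below_ofilter[OF r le]]
    by blast
  then show ?thesis
    using Restr_subset[OF infinite_cardinals_below_mono[OF le, of r], of r]
      Restr_subset[of "infinite_cardinals_below r \<mu>" "infinite_cardinals_below r \<mu>" r] by simp
qed

text \<open>
  The larger list properly extends the smaller one because it contains \<open>\<nu>\<close> itself.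
\<close>

lemma Restr_infinite_cardinals_below_strict_mono:
  assumes r: "Well_order r" and \<nu>: "Cinfinite \<nu>" and less: "\<nu> <o \<mu>" and le: "\<mu> \<le>o r"
  shows "Restr r (infinite_cardinals_below r \<nu>) <o Restr r (infinite_cardinals_below r \<mu>)"
proof -
  let ?R = "Restr r (infinite_cardinals_below r \<mu>)"
  have le': "\<nu> \<le>o \<mu>"
    using less by (rule ordLess_imp_ordLeq)
  have wo: "Well_order \<nu>"
    using \<nu> by (simp add: card_order_on_well_order_on)
  obtain z where z: "z \<in> Field r" "\<nu> =o initial_segment r z"
    using ordLess_ordLeq_trans[OF less le] ordLess_iff_ordIso_Restr[OF r wo] by blast
  have "z \<in> infinite_cardinals_below r \<mu>"
    using z less Cinfinite_cong[OF z(2) \<nu>] ordIso_ordLess_trans[OF ordIso_symmetric[OF z(2)]]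
    unfolding infinite_cardinals_below_def by blast
  moreover have "z \<notin> infinite_cardinals_below r \<nu>"
    using z(2) not_ordLess_ordIso ordIso_symmetric
    unfolding infinite_cardinals_below_def by blast
  ultimately have "infinite_cardinals_below r \<nu> \<subset> Field ?R"
    using infinite_cardinals_below_mono[OF le', of r]
    unfolding Field_Restr_infinite_cardinals_below[OF r] by blast
  then have "Restr ?R (infinite_cardinals_below r \<nu>) <o ?R"
    using ofilter_ordLess[OF Well_order_Restr[OF r] infinite_cardinals_below_ofilter[OF r le']]
    by blast
  then show ?thesis
    using Restr_subset[OF infinite_cardinals_below_mono[OF le', of r], of r] by simp
qed

lemma is_ord_succ_least:
  fixes \<alpha> \<beta> :: "'a rel" and \<rho> :: "'b rel"
  assumes succ: "is_ord_succ \<beta> \<alpha>" and less: "\<beta> <o \<rho>"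
  shows "\<alpha> \<le>o \<rho>"
proof (rule ccontr)
  assume "\<not> \<alpha> \<le>o \<rho>"
  moreover have "Well_order \<alpha>" "Well_order \<rho>"
    using succ less ordLess_imp_ordLeq ordLeq_Well_order_simp unfolding is_ord_succ_def by blast+
  ultimately have "\<rho> <o \<alpha>"
    using not_ordLeq_iff_ordLess by blast
  \<comment> \<open>Minimality of \<open>\<alpha>\<close> refers to relations on its own type, so \<open>\<rho>\<close> is copied there.\<close>
  then obtain p :: "'a rel" where p: "\<rho> =o p" "p <o \<alpha>"
    unfolding internalize_ordLess[of \<rho> \<alpha>] by blast
  then have "\<beta> <o p"
    using less ordLess_ordIso_trans by blast
  then show False
    using succ p(2) not_ordLess_ordLeq unfolding is_ord_succ_def by blast
qed

lemma is_limit_ord_least: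
  fixes \<alpha> :: "'a rel" and \<rho> :: "'b rel"
  assumes lim: "is_limit_ord \<alpha>" and \<rho>: "Well_order \<rho>" and le: "\<And>\<beta> :: 'a rel. \<beta> <o \<alpha> \<Longrightarrow> \<beta> \<le>o \<rho>"
  shows "\<alpha> \<le>o \<rho>"
proof (rule ccontr)
  assume "\<not> \<alpha> \<le>o \<rho>"
  moreover have \<alpha>: "Well_order \<alpha>"
    using lim by (simp add: is_limit_ord_def)
  ultimately have "\<rho> <o \<alpha>"
    using \<rho> not_ordLeq_iff_ordLess by blast
  then obtain p :: "'a rel" where p: "\<rho> =o p" "p <o \<alpha>"
    unfolding internalize_ordLess[of \<rho> \<alpha>] by blast
  then obtain \<gamma> :: "'a rel" where \<gamma>: "p <o \<gamma>" "\<not> \<alpha> \<le>o \<gamma>"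
    using lim unfolding is_limit_ord_def is_ord_succ_def by blast
  then have "\<gamma> <o \<alpha>"
    using \<alpha> ordLess_imp_ordLeq ordLeq_Well_order_simp not_ordLeq_iff_ordLess by blast
  then have "\<gamma> \<le>o p"
    using le p(1) ordLeq_ordIso_trans by blast
  then show False
    using \<gamma>(1) not_ordLess_ordLeq by blast
qed

text \<open>
  At limits, the supremum \<open>\<mu>\<close> of infinite cardinals is again a cardinal: each of these cardinals
  is at most \<open>|Field \<mu>|\<close>, so leastness gives \<open>\<mu> \<le>o |Field \<mu>|\<close>.
\<close>

lemma is_aleph_Cinfinite:
  fixes \<alpha> :: "'a rel" and \<mu> :: "'b rel"
  assumes "is_aleph \<alpha> \<mu>"
  shows "Well_order \<alpha> \<and> Cinfinite \<mu>"
  using assms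
proof (induction rule: is_aleph.induct)
  case (zero \<alpha> \<mu>)
  then show ?case
    using Cinfinite_cong[OF ordIso_symmetric natLeq_Cinfinite] by blast
next
  case (succ \<beta> \<alpha> \<nu> \<mu>)
  have "Cinfinite (cardSuc \<nu>)"
    using succ.IH cardSuc_Card_order cardSuc_finite unfolding cinfinite_def by blast
  then show ?case
    using succ.hyps Cinfinite_cong[OF ordIso_symmetric] ordLess_imp_ordLeq ordLeq_Well_order_simp
    unfolding is_ord_succ_def by blast
next
  case (limit \<alpha> A \<mu>)
  have \<alpha>: "Well_order \<alpha>" "Field \<alpha> \<noteq> {}"
    using limit.hyps(1) unfolding is_limit_ord_def by blast+
  have inf: "Cinfinite (A \<beta>)" and le: "A \<beta> \<le>o \<mu>" if "\<beta> <o \<alpha>" for \<beta>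
    using that limit.IH limit.hyps(2) unfolding is_ord_sup_def by blast+
  have "A \<beta> \<le>o |Field \<mu>|" if "\<beta> <o \<alpha>" for \<beta>
    using ordIso_ordLeq_trans[OF ordIso_symmetric[OF card_of_Field_ordIso] card_of_mono2]
      inf[OF that] le[OF that] by blast
  then have "\<mu> \<le>o |Field \<mu>|"
    using limit.hyps(2) card_of_Well_order unfolding is_ord_sup_def by blast
  then have card: "Card_order \<mu>"
    by (simp add: Card_order_iff_ordLeq_card_of)
  obtain \<beta> :: "'a rel" where "\<beta> <o \<alpha>"
    using underS_Restr_ordLess[OF \<alpha>] by blast
  then have "cinfinite \<mu>"
    using inf le cinfinite_mono by blast
  then show ?case
    using card \<alpha> by blast
qed

text \<open>
  By induction along the hierarchy: a successor step adds at least one cardinal, and at a limit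
  the order type of the cardinals below \<open>\<mu>\<close> bounds every earlier index.
\<close>

lemma is_aleph_ordLeq_infinite_cardinals_below:
  fixes \<alpha> :: "'a rel" and \<mu> :: "'b rel"
  assumes "is_aleph \<alpha> \<mu>" and "Well_order r" and "\<mu> \<le>o r"
  shows "\<alpha> \<le>o Restr r (infinite_cardinals_below r \<mu>)"
  using assms
proof (induction rule: is_aleph.induct)
  case (zero \<alpha> \<mu>)
  then show ?case
    using ordLeq_iff_ordLess_Restr[OF zero(1) Well_order_Restr[OF zero(4)]] by blast
next
  case (succ \<beta> \<alpha> \<nu> \<mu>)
  have \<nu>: "Cinfinite \<nu>"
    using is_aleph_Cinfinite[OF succ.hyps(2)] by blast
  have less: "\<nu> <o \<mu>"
    using cardSuc_greater[of \<nu>] \<nu> ordLess_ordIso_trans[OF _ ordIso_symmetric[OF succ.hyps(3)]]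
    by blast
  have "\<nu> \<le>o r"
    using ordLess_ordLeq_trans[OF less succ.prems(2)] by (rule ordLess_imp_ordLeq)
  then have "\<beta> \<le>o Restr r (infinite_cardinals_below r \<nu>)"
    using succ.IH succ.prems(1) by blast
  also have "Restr r (infinite_cardinals_below r \<nu>) <o Restr r (infinite_cardinals_below r \<mu>)"
    by (rule Restr_infinite_cardinals_below_strict_mono[OF succ.prems(1) \<nu> less succ.prems(2)])
  finally show ?case
    using is_ord_succ_least[OF succ.hyps(1)] by blast
next
  case (limit \<alpha> A \<mu>)
  show ?case
  proof (rule is_limit_ord_least[OF limit.hyps(1) Well_order_Restr[OF limit.prems(1)]])
    fix \<beta> :: "'a rel"
    assume \<beta>: "\<beta> <o \<alpha>"
    then have le: "A \<beta> \<le>o \<mu>"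
      using limit.hyps(2) unfolding is_ord_sup_def by blast
    have "\<beta> \<le>o Restr r (infinite_cardinals_below r (A \<beta>))"
      using limit.IH \<beta> limit.prems ordLeq_transitive[OF le] by blast
    also have "Restr r (infinite_cardinals_below r (A \<beta>)) \<le>o
        Restr r (infinite_cardinals_below r \<mu>)"
      by (rule Restr_infinite_cardinals_below_mono[OF limit.prems(1) le])
    finally show "\<beta> \<le>o Restr r (infinite_cardinals_below r \<mu>)" .
  qed
qed

text \<open>
  The labels come from embedding \<open>s\<close> into the increasing list of infinite cardinals below \<open>\<kappa>\<close>. An
  embedding maps the predecessors of \<open>x\<close> injectively below the image of \<open>x\<close>, which bounds their
  number by the label of \<open>x\<close>.
\<close>

lemma aleph_fixed_point_cardinal_labels:
  fixes \<kappa> :: "'k rel" and s :: "'a rel"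
  assumes fp: "aleph_fixed_point \<kappa>" and iso: "s =o \<kappa>"
  obtains c :: "'a \<Rightarrow> 'k rel"
  where "\<forall>x\<in>Field s. Cinfinite (c x) \<and> c x <o \<kappa> \<and> |underS s x| \<le>o c x"
    and "\<forall>x\<in>Field s. \<forall>y\<in>Field s. c x =o c y \<longrightarrow> x = y"
proof -
  have aleph: "is_aleph \<kappa> \<kappa>" and \<kappa>: "Well_order \<kappa>"
    using fp is_aleph_Cinfinite unfolding aleph_fixed_point_def by blast+
  define N where "N = infinite_cardinals_below \<kappa> \<kappa>"
  let ?R = "Restr \<kappa> N"
  have R: "Well_order ?R"
    by (rule Well_order_Restr[OF \<kappa>])
  have "s \<le>o ?R"
    using is_aleph_ordLeq_infinite_cardinals_below[OF aleph \<kappa> ordLeq_reflexive[OF \<kappa>]]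
      ordIso_ordLeq_trans[OF iso] unfolding N_def by blast
  then obtain f where s: "Well_order s" and f: "embed s ?R f"
    unfolding ordLeq_def by blast
  have FR: "Field ?R = N"
    unfolding N_def by (rule Field_Restr_infinite_cardinals_below[OF \<kappa>])
  have fN: "f x \<in> N" if "x \<in> Field s" for x
    using embed_in_Field[OF f that] FR by blast
  have inj: "inj_on f (Field s)"
    by (rule embed_inj_on[OF s f])
  show ?thesis
  proof (rule that[of "\<lambda>x. initial_segment \<kappa> (f x)"]; intro ballI impI)
    fix x
    assume x: "x \<in> Field s"
    have label: "Cinfinite (initial_segment \<kappa> (f x))" "initial_segment \<kappa> (f x) <o \<kappa>"
      using fN[OF x] unfolding N_def infinite_cardinals_below_def by blast+
    have "bij_betw f (underS s x) (underS ?R (f x))"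
      by (rule embed_underS[OF s f x])
    then have "inj_on f (underS s x)" "f ` underS s x \<subseteq> underS \<kappa> (f x)"
      unfolding bij_betw_def underS_def by blast+
    then have "|underS s x| \<le>o |underS \<kappa> (f x)|"
      unfolding card_of_ordLeq[symmetric] by blast
    also have "|underS \<kappa> (f x)| =o initial_segment \<kappa> (f x)"
      using card_of_Field_ordIso[of "initial_segment \<kappa> (f x)"] label(1)
      unfolding Field_initial_segment[OF \<kappa>] by blast
    finally show "Cinfinite (initial_segment \<kappa> (f x)) \<and> initial_segment \<kappa> (f x) <o \<kappa> \<and>
        |underS s x| \<le>o initial_segment \<kappa> (f x)"
      using label by blast
  next
    fix x y
    assume x: "x \<in> Field s" and y: "y \<in> Field s"
      and eq: "initial_segment \<kappa> (f x) =o initial_segment \<kappa> (f y)"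
    have "f x = f y"
      using initial_segment_ordIso_imp_eq[OF \<kappa> _ _ eq] fN[OF x] fN[OF y]
      unfolding N_def infinite_cardinals_below_def by blast
    then show "x = y"
      using inj x y by (simp add: inj_on_def)
  qed
qed

section \<open>Subgraphs with prescribed infinite degrees\<close>

lemma singleton_ordLeq_Cinfinite:
  assumes "Cinfinite \<kappa>"
  shows "|{x}| \<le>o \<kappa>"
proof (rule ordLess_imp_ordLeq, rule finite_ordLess_infinite[OF card_of_Well_order])
  show "Well_order \<kappa>" "\<not> finite (Field \<kappa>)"
    using assms card_order_on_well_order_on unfolding cinfinite_def by blast+
qed (simp add: Field_card_of)

lemma neighbours_subset:
  assumes "simple_graph V E"
  shows "neighbours E v \<subseteq> V"
  using assms unfolding simple_graph_def neighbours_def by blast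

text \<open>
  At most \<open>\<kappa>\<close> vertices are endpoints of walks of length \<open>n\<close> from a given vertex, by induction on
  \<open>n\<close>, and by connectedness these countably many sets of endpoints exhaust \<open>V\<close>.
\<close>

lemma connected_regular_graph_card:
  assumes G: "simple_graph V E" "connected_graph V E" "regular_graph \<kappa> V E"
    and \<kappa>: "Cinfinite \<kappa>" and v: "v \<in> V"
  shows "|V| =o \<kappa>"
proof -
  have inf: "\<not> finite (Field \<kappa>)" and card: "Card_order \<kappa>"
    using \<kappa> unfolding cinfinite_def by blast+
  let ?R = "{(x, y). {x, y} \<in> E}"
  have step: "(?R ^^ Suc n) `` {v} = (\<Union>u\<in>(?R ^^ n) `` {v}. neighbours E u)" for n
    by (auto simp: neighbours_def relcomp_unfold)
  have ball: "(?R ^^ n) `` {v} \<subseteq> V \<and> |(?R ^^ n) `` {v}| \<le>o \<kappa>" for n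
  proof (induction n)
    case 0
    have "|{v}| \<le>o \<kappa>"
      by (rule singleton_ordLeq_Cinfinite[OF \<kappa>])
    then show ?case
      using v by simp
  next
    case (Suc n)
    have "\<forall>u\<in>(?R ^^ n) `` {v}. |neighbours E u| \<le>o \<kappa>"
      using Suc.IH G(3) ordIso_imp_ordLeq unfolding regular_graph_def by blast
    then have "|\<Union>u\<in>(?R ^^ n) `` {v}. neighbours E u| \<le>o \<kappa>"
      using card_of_UNION_ordLeq_infinite_Field[OF inf card] Suc.IH by blast
    then show ?case
      unfolding step using neighbours_subset[OF G(1)] by blast
  qed
  have "|UNIV :: nat set| \<le>o \<kappa>"
    using ordIso_ordLeq_trans[OF card_of_nat natLeq_ordLeq_cinfinite[OF \<kappa>]] .
  then have "|\<Union>n\<in>(UNIV :: nat set). (?R ^^ n) `` {v}| \<le>o \<kappa>"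
    by (rule card_of_UNION_ordLeq_infinite_Field[OF inf card]) (simp add: ball)
  moreover have "V \<subseteq> (\<Union>n\<in>(UNIV :: nat set). (?R ^^ n) `` {v})"
  proof
    fix w
    assume "w \<in> V"
    then have "(v, w) \<in> ?R\<^sup>*"
      using G(2) v unfolding connected_graph_def by blast
    then obtain n where "(v, w) \<in> ?R ^^ n"
      using rtrancl_imp_relpow by blast
    then show "w \<in> (\<Union>n\<in>(UNIV :: nat set). (?R ^^ n) `` {v})"
      by blast
  qed
  ultimately have "|V| \<le>o \<kappa>"
    using ordLeq_transitive[OF card_of_mono1] by blast
  moreover have "\<kappa> =o |neighbours E v|"
    using G(3) v ordIso_symmetric unfolding regular_graph_def by blast
  then have "\<kappa> \<le>o |V|"
    by (rule ordIso_ordLeq_trans[OF _ card_of_mono1[OF neighbours_subset[OF G(1)]]])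
  ultimately show ?thesis
    by (simp add: ordIso_iff_ordLeq)
qed

text \<open>
  Each vertex \<open>v\<close> chooses \<open>c v\<close> neighbours among the later vertices. The edges chosen by others
  that end in \<open>v\<close> come from predecessors, and \<open>c v\<close> absorbs their number.
\<close>

lemma spanning_subgraph_with_degrees:
  fixes c :: "'v \<Rightarrow> 'k rel"
  assumes reg: "regular_graph \<kappa> V E" and \<kappa>: "Cinfinite \<kappa>" and s: "well_order_on V s"
    and labels: "\<forall>v\<in>V. Cinfinite (c v) \<and> c v <o \<kappa> \<and> |underS s v| \<le>o c v"
  obtains F where "F \<subseteq> E" and "\<forall>v\<in>V. |neighbours F v| =o c v"
proof -
  note c = bspec[OF labels]
  have refl: "(v, v) \<in> s" if "v \<in> V" for v
    using s that unfolding well_order_on_def linear_order_on_def partial_order_on_def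
      preorder_on_def refl_on_def by blast
  have total: "(v, w) \<in> s \<or> (w, v) \<in> s" if "v \<in> V" "w \<in> V" for v w
    using s that refl unfolding well_order_on_def linear_order_on_def total_on_def
    by (cases "v = w") auto
  have "\<exists>S. S \<subseteq> neighbours E v - under s v \<and> |S| =o c v" if v: "v \<in> V" for v
  proof -
    let ?L = "neighbours E v - under s v"
    have inf: "\<not> finite (Field (c v))" and card: "Card_order (c v)" and less: "c v <o \<kappa>"
      using c[OF v] unfolding cinfinite_def by blast+
    have "|{v}| \<le>o c v"
      by (rule singleton_ordLeq_Cinfinite[OF conjunct1[OF c[OF v]]])
    then have "|underS s v \<union> {v}| \<le>o c v"
      using card_of_Un_ordLeq_infinite_Field[OF inf _ _ card] c[OF v] by blast
    moreover have "under s v \<subseteq> underS s v \<union> {v}"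
      by (auto simp: under_def underS_def)
    ultimately have "|under s v| \<le>o c v"
      using ordLeq_transitive[OF card_of_mono1] by blast
    then have under: "|under s v| <o \<kappa>"
      by (rule ordLeq_ordLess_trans[OF _ less])
    have "c v \<le>o |?L|"
    proof (rule ccontr)
      assume "\<not> c v \<le>o |?L|"
      then have "|?L| <o c v"
        using card not_ordLeq_iff_ordLess card_of_Well_order card_order_on_well_order_on by blast
      then have "|?L| <o \<kappa>"
        using less ordLess_transitive by blast
      then have "|?L \<union> under s v| <o \<kappa>"
        using card_of_Un_ordLess_infinite_Field[OF _ _ _ under] \<kappa> unfolding cinfinite_def by blast
      moreover have "neighbours E v \<subseteq> ?L \<union> under s v"
        by blast
      ultimately have "|neighbours E v| <o \<kappa>"
        using ordLeq_ordLess_trans[OF card_of_mono1] by blast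
      then show False
        using reg v not_ordLess_ordIso unfolding regular_graph_def by blast
    qed
    then have "|Field (c v)| \<le>o |?L|"
      using card_of_Field_ordIso[OF card] ordIso_ordLeq_trans by blast
    then obtain g where g: "inj_on g (Field (c v))" "g ` Field (c v) \<subseteq> ?L"
      unfolding card_of_ordLeq[symmetric] by blast
    have "|Field (c v)| =o |g ` Field (c v)|"
      unfolding card_of_ordIso[symmetric] using inj_on_imp_bij_betw[OF g(1)] by blast
    then have "|g ` Field (c v)| =o c v"
      by (rule ordIso_transitive[OF ordIso_symmetric card_of_Field_ordIso[OF card]])
    then show ?thesis
      using g(2) by blast
  qed
  then have "\<forall>v\<in>V. \<exists>S. S \<subseteq> neighbours E v - under s v \<and> |S| =o c v"
    by blast
  from bchoice[OF this] obtain S where S: "\<And>v. v \<in> V \<Longrightarrow> S v \<subseteq> neighbours E v - under s v"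
      "\<And>v. v \<in> V \<Longrightarrow> |S v| =o c v"
    by blast
  define F where "F = {{v, u} |v u. v \<in> V \<and> u \<in> S v}"
  show ?thesis
  proof (rule that[of F]; (intro ballI)?)
    show "F \<subseteq> E"
      using S(1) unfolding F_def neighbours_def by blast
  next
    fix v
    assume v: "v \<in> V"
    have "w \<in> underS s v" if "w \<in> V" "v \<in> S w" for w
      using that S(1)[OF that(1)] total[OF v that(1)] refl[OF v] unfolding under_def underS_def by blast
    then have "neighbours F v \<subseteq> S v \<union> underS s v"
      unfolding neighbours_def F_def by (auto simp: doubleton_eq_iff)
    moreover have "|S v \<union> underS s v| \<le>o c v"
      using card_of_Un_ordLeq_infinite_Field[of "c v"] c[OF v] ordIso_imp_ordLeq[OF S(2)[OF v]]
      unfolding cinfinite_def by blast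
    ultimately have "|neighbours F v| \<le>o c v"
      using ordLeq_transitive[OF card_of_mono1] by blast
    moreover have "S v \<subseteq> neighbours F v"
      using v unfolding neighbours_def F_def by blast
    then have "c v \<le>o |neighbours F v|"
      using ordIso_ordLeq_trans[OF ordIso_symmetric[OF S(2)[OF v]]] card_of_mono1 by blast
    ultimately show "|neighbours F v| =o c v"
      by (simp add: ordIso_iff_ordLeq)
  qed
qed

section \<open>Distinguishing colourings\<close>

lemma distinguishing_if_red_degrees_distinct:
  assumes G: "simple_graph V E" and F: "F \<subseteq> E" and ab: "a \<noteq> b"
    and distinct: "\<And>v w. \<lbrakk>v \<in> V; w \<in> V; |neighbours F v| =o |neighbours F w|\<rbrakk> \<Longrightarrow> v = w"
  shows "distinguishing_colouring V E (\<lambda>e. if e \<in> F then a else b)"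
  unfolding distinguishing_colouring_def
proof (intro allI impI ballI, elim conjE)
  fix \<phi> v
  assume aut: "graph_automorphism V E \<phi>" and v: "v \<in> V"
    and "\<forall>e\<in>E. (if \<phi> ` e \<in> F then a else b) = (if e \<in> F then a else b)"
  then have pres: "\<phi> ` e \<in> F \<longleftrightarrow> e \<in> F" if "e \<in> E" for e
    using that ab by (auto split: if_splits)
  have bij: "bij_betw \<phi> V V"
    and edge: "\<And>x y. \<lbrakk>x \<in> V; y \<in> V\<rbrakk> \<Longrightarrow> {\<phi> x, \<phi> y} \<in> E \<longleftrightarrow> {x, y} \<in> E"
    using aut unfolding graph_automorphism_def by blast+
  have FV: "neighbours F x \<subseteq> V" for x
    using neighbours_subset[OF G, of x] F unfolding neighbours_def by blast
  have "\<phi> ` neighbours F v = neighbours F (\<phi> v)"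
  proof (intro equalityI subsetI)
    fix w
    assume "w \<in> \<phi> ` neighbours F v"
    then obtain u where "w = \<phi> u" "{v, u} \<in> F"
      unfolding neighbours_def by blast
    then show "w \<in> neighbours F (\<phi> v)"
      using pres[of "{v, u}"] F unfolding neighbours_def by auto
  next
    fix w
    assume w: "w \<in> neighbours F (\<phi> v)"
    then obtain u where u: "u \<in> V" "w = \<phi> u"
      using FV bij unfolding bij_betw_def by blast
    then have red: "{\<phi> v, \<phi> u} \<in> F"
      using w unfolding neighbours_def by blast
    then have "{v, u} \<in> E"
      using edge[OF v u(1)] F by blast
    then have "{v, u} \<in> F"
      using red pres[of "{v, u}"] by simp
    then show "w \<in> \<phi> ` neighbours F v"
      using u(2) unfolding neighbours_def by blast
  qed
  moreover have "inj_on \<phi> (neighbours F v)"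
    by (rule inj_on_subset[OF bij_betw_imp_inj_on[OF bij] FV])
  ultimately have "|neighbours F v| =o |neighbours F (\<phi> v)|"
    unfolding card_of_ordIso[symmetric] bij_betw_def by blast
  moreover have "\<phi> v \<in> V"
    using bij v bij_betwE by blast
  ultimately show "\<phi> v = v"
    using distinct[OF v, of "\<phi> v"] by simp
qed

lemma aleph_fixed_point_regular_graph_distinguishing:
  fixes \<kappa> :: "'k rel" and V :: "'v set"
  assumes fp: "aleph_fixed_point \<kappa>" and G: "simple_graph V E" "connected_graph V E"
    and reg: "regular_graph \<kappa> V E" and ab: "a \<noteq> b"
  obtains F where "distinguishing_colouring V E (\<lambda>e. if e \<in> F then a else b)"
proof (cases "V = {}")
  case True
  then show ?thesis
    using that unfolding distinguishing_colouring_def by blast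
next
  case False
  have \<kappa>: "Cinfinite \<kappa>"
    using fp is_aleph_Cinfinite unfolding aleph_fixed_point_def by blast
  have "|V| =o \<kappa>"
    using connected_regular_graph_card[OF G reg \<kappa>] False by blast
  note labels = aleph_fixed_point_cardinal_labels[OF fp this, unfolded Field_card_of]
  obtain c :: "'v \<Rightarrow> 'k rel" where
    c: "\<forall>v\<in>V. Cinfinite (c v) \<and> c v <o \<kappa> \<and> |underS (card_of V) v| \<le>o c v"
    and c_inj: "\<forall>v\<in>V. \<forall>w\<in>V. c v =o c w \<longrightarrow> v = w"
    by (rule labels)
  obtain F where F: "F \<subseteq> E" "\<forall>v\<in>V. |neighbours F v| =o c v"
    by (rule spanning_subgraph_with_degrees[OF reg \<kappa> card_of_well_order_on c])
  have "v = w" if "v \<in> V" "w \<in> V" "|neighbours F v| =o |neighbours F w|" for v w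
  proof (rule c_inj[rule_format, OF that(1,2)])
    have "c v =o |neighbours F v|"
      by (rule ordIso_symmetric[OF bspec[OF F(2) that(1)]])
    also note that(3)
    also have "|neighbours F w| =o c w"
      by (rule bspec[OF F(2) that(2)])
    finally show "c v =o c w" .
  qed
  then show ?thesis
    using that distinguishing_if_red_degrees_distinct[OF G(1) F(1) ab] by blast
qed

lemma distinguishing_index_exists:
  fixes c :: "'v set \<Rightarrow> 'v set"
  assumes c: "distinguishing_colouring V E c"
  obtains d where "is_distinguishing_index V E d" and "d \<le>o |c ` E|"
proof -
  let ?D = "{|c ` E| |c :: 'v set \<Rightarrow> 'v set. distinguishing_colouring V E c}"
  have "\<exists>d\<in>?D. \<forall>d'\<in>?D. d \<le>o d'"
    using c by (intro exists_minim_Card_order) (auto intro: card_of_Card_order)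
  then obtain d where d: "d \<in> ?D" "\<forall>d'\<in>?D. d \<le>o d'"
    by blast
  have "is_distinguishing_index V E d"
    unfolding is_distinguishing_index_def using d ordIso_reflexive card_of_Well_order by blast
  then show ?thesis
    using that d(2) c by blast
qed

theorem theorem5:
  fixes \<kappa> :: "'k rel" and V :: "'v set" and E :: "'v set set"
  assumes "aleph_fixed_point \<kappa>"
    and "simple_graph V E"
    and "connected_graph V E"
    and "regular_graph \<kappa> V E"
  shows "\<exists>d. is_distinguishing_index V E d \<and> d \<le>o ctwo"
proof -
  have two: "({} :: 'v set) \<noteq> UNIV"
    by simp
  obtain F where F: "distinguishing_colouring V E (\<lambda>e. if e \<in> F then {} :: 'v set else UNIV)"
    using aleph_fixed_point_regular_graph_distinguishing[OF assms two] by blast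
  let ?c = "\<lambda>e. if e \<in> F then {} :: 'v set else UNIV"
  obtain d where d: "is_distinguishing_index V E d" "d \<le>o |?c ` E|"
    using distinguishing_index_exists[OF F] by blast
  have "?c ` E \<subseteq> {{}, UNIV}"
    by auto
  then have "|?c ` E| \<le>o |{{}, UNIV :: 'v set}|"
    by (rule card_of_mono1)
  also have "|{{}, UNIV :: 'v set}| =o ctwo"
    unfolding ctwo_def by (rule ordIso_symmetric[OF card_of_bool[OF two]])
  finally show ?thesis
    using d ordLeq_transitive by blast
qed

end
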